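(* Let $(\Omega,\mathcal{F},\mathbb{P})$ be a probability space, let $\mathcal{G}\subset\mathcal{F}$ be a $\sigma$-algebra, let $X\in L^2(\Omega,\mathcal{F},\mathbb{P})$ and let $\xi\in L^2(\Omega,\mathcal{G},\mathbb{P})$. Then $\xi$ is the conditional expectation $\mathbb{E}(X\,|\,\mathcal{G})$ if and only if $\xi$ is the unique critical point of the functional $J:L^2(\Omega,\mathcal{G},\mathbb{P})\to\mathbb{R}$ given by $$J(Y):=\frac{1}{2}\int_{\Omega}|Y|^2\,d\mathbb{P}-\int_{\Omega}X\cdot Y\,d\mathbb{P}.$$
   Context: All random variables are real-valued, and two random variables are identified if they are equal almost surely. $L^2(\Omega,\mathcal{G},\mathbb{P})$ denotes the square-integrable $\mathcal{G}$-measurable random variables, with $\mathbb{P}$ restricted to $\mathcal{G}$; it is a closed linear subspace of $L^2(\Omega,\mathcal{F},\mathbb{P})$ and a real Hilbert space with inner product $\langle X,Y\rangle_2=\int_\Omega X\cdot Y\,d\mathbb{P}$. Conditional expectation: for an integrable $X:\Omega\to\mathbb{R}$, the conditional expectation $\mathbb{E}(X\,|\,\mathcal{G})$ is the (almost surely unique) $\mathcal{G}$-measurable integrable function such that $\int_B X\,d\mathbb{P}=\int_B\mathbb{E}(X\,|\,\mathcal{G})\,d\mathbb{P}$ for all $B\in\mathcal{G}$. Critical point: for a real Hilbert space $H$, a function $F:H\to\mathbb{R}$ is Gateaux-differentiable at $u\in H$ if for every $v\in H$ the limit $F'_u(v):=\lim_{t\to0}\frac{F(u+tv)-F(u)}{t}$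 exists and $F'_u:H\to\mathbb{R}$ is linear and continuous. A point $u_0\in H$ is a critical point of $F$ if $F'_{u_0}(v)=0$ for all $v\in H$. *)

theory Defs
  imports "HOL-Probability.Probability"
begin

text \<open>
  Elements of \<open>L\<^sup>2\<close> are represented by square-integrable measurable functions; two of them
  denote the same element iff they agree almost everywhere.  Hence \<open>l2_norm\<close> is only a
  seminorm on representatives, and uniqueness below means uniqueness up to almost everywhere
  equality.  The space \<open>L\<^sup>2(\<Omega>, \<G>, P)\<close>, with \<open>P\<close> restricted to \<open>\<G>\<close>, is
  \<open>L2_space (restr_to_subalg M G)\<close>.
\<close>

definition L2_space :: "'a measure \<Rightarrow> ('a \<Rightarrow> real) set" where
  "L2_space N = {Y \<in> borel_measurable N. integrable N (\<lambda>\<omega>. (Y \<omega>)\<^sup>2)}"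

definition l2_inner :: "'a measure \<Rightarrow> ('a \<Rightarrow> real) \<Rightarrow> ('a \<Rightarrow> real) \<Rightarrow> real" where
  "l2_inner N Y Z = (\<integral>\<omega>. Y \<omega> * Z \<omega> \<partial>N)"

definition l2_norm :: "'a measure \<Rightarrow> ('a \<Rightarrow> real) \<Rightarrow> real" where
  "l2_norm N Y = sqrt (l2_inner N Y Y)"

definition l2_linear :: "'a measure \<Rightarrow> (('a \<Rightarrow> real) \<Rightarrow> real) \<Rightarrow> bool" where
  "l2_linear N D \<longleftrightarrow>
     (\<forall>v\<in>L2_space N. \<forall>w\<in>L2_space N. D (\<lambda>\<omega>. v \<omega> + w \<omega>) = D v + D w) \<and>
     (\<forall>v\<in>L2_space N. \<forall>c. D (\<lambda>\<omega>. c * v \<omega>) = c * D v)"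

definition l2_continuous :: "'a measure \<Rightarrow> (('a \<Rightarrow> real) \<Rightarrow> real) \<Rightarrow> bool" where
  "l2_continuous N D \<longleftrightarrow>
     (\<forall>v\<in>L2_space N. \<forall>e>0. \<exists>d>0. \<forall>w\<in>L2_space N.
        l2_norm N (\<lambda>\<omega>. w \<omega> - v \<omega>) < d \<longrightarrow> \<bar>D w - D v\<bar> < e)"

definition has_gateaux_derivative ::
  "'a measure \<Rightarrow> (('a \<Rightarrow> real) \<Rightarrow> real) \<Rightarrow> ('a \<Rightarrow> real) \<Rightarrow> (('a \<Rightarrow> real) \<Rightarrow> real) \<Rightarrow> bool" where
  "has_gateaux_derivative N F u D \<longleftrightarrow>
     (\<forall>v\<in>L2_space N. ((\<lambda>t. (F (\<lambda>\<omega>. u \<omega> + t * v \<omega>) - F u) / t) \<longlongrightarrow> D v) (at 0)) \<and>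
     l2_linear N D \<and> l2_continuous N D"

definition critical_point ::
  "'a measure \<Rightarrow> (('a \<Rightarrow> real) \<Rightarrow> real) \<Rightarrow> ('a \<Rightarrow> real) \<Rightarrow> bool" where
  "critical_point N F u \<longleftrightarrow>
     u \<in> L2_space N \<and>
     (\<exists>D. has_gateaux_derivative N F u D \<and> (\<forall>v\<in>L2_space N. D v = 0))"

definition unique_critical_point ::
  "'a measure \<Rightarrow> (('a \<Rightarrow> real) \<Rightarrow> real) \<Rightarrow> ('a \<Rightarrow> real) \<Rightarrow> bool" where
  "unique_critical_point N F u \<longleftrightarrow>
     critical_point N F u \<and> (\<forall>w. critical_point N F w \<longrightarrow> (AE \<omega> in N. w \<omega> = u \<omega>))"

definition J_functional :: "'a measure \<Rightarrow> ('a \<Rightarrow> real) \<Rightarrow> ('a \<Rightarrow> real) \<Rightarrow> real" where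
  "J_functional M X Y = 1 / 2 * (\<integral>\<omega>. \<bar>Y \<omega>\<bar>\<^sup>2 \<partial>M) - (\<integral>\<omega>. X \<omega> * Y \<omega> \<partial>M)"

text \<open>The functional is well defined on almost-everywhere classes.\<close>

lemma J_functional_cong_AE:
  assumes [measurable]: "X \<in> borel_measurable M" "Y \<in> borel_measurable M" "Z \<in> borel_measurable M"
    and "AE \<omega> in M. Y \<omega> = Z \<omega>"
  shows "J_functional M X Y = J_functional M X Z"
proof -
  have "(\<integral>\<omega>. \<bar>Y \<omega>\<bar>\<^sup>2 \<partial>M) = (\<integral>\<omega>. \<bar>Z \<omega>\<bar>\<^sup>2 \<partial>M)"
    by (rule integral_cong_AE) (use assms(4) in auto)
  moreover have "(\<integral>\<omega>. X \<omega> * Y \<omega> \<partial>M) = (\<integral>\<omega>. X \<omega> * Z \<omega> \<partial>M)"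
    by (rule integral_cong_AE) (use assms(4) in auto)
  ultimately show ?thesis
    by (simp add: J_functional_def)
qed

text \<open>
  For an integrable measurable \<open>\<xi>\<close>, almost everywhere equality with \<^const>\<open>real_cond_exp\<close> is the
  usual defining property of the conditional expectation.
\<close>

lemma AE_eq_real_cond_exp_iff:
  assumes "prob_space M" "subalgebra M G" "integrable M X"
    and "\<xi> \<in> borel_measurable G" "integrable M \<xi>"
  shows "(AE \<omega> in M. \<xi> \<omega> = real_cond_exp M G X \<omega>) \<longleftrightarrow>
    (\<forall>B\<in>sets G. (\<integral>\<omega>\<in>B. X \<omega> \<partial>M) = (\<integral>\<omega>\<in>B. \<xi> \<omega> \<partial>M))"
proof -
  interpret prob_space M by fact
  interpret finite_measure_subalgebra M G
    by unfold_locales fact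
  show ?thesis
  proof
    assume ae: "AE \<omega> in M. \<xi> \<omega> = real_cond_exp M G X \<omega>"
    show "\<forall>B\<in>sets G. (\<integral>\<omega>\<in>B. X \<omega> \<partial>M) = (\<integral>\<omega>\<in>B. \<xi> \<omega> \<partial>M)"
    proof
      fix B assume B: "B \<in> sets G"
      then have [measurable]: "B \<in> sets M"
        using assms(2) by (auto simp: subalgebra_def)
      have [measurable]: "\<xi> \<in> borel_measurable M"
        using assms(5) by simp
      have "(\<integral>\<omega>\<in>B. X \<omega> \<partial>M) = (\<integral>\<omega>\<in>B. real_cond_exp M G X \<omega> \<partial>M)"
        by (rule real_cond_exp_intA[OF assms(3) B])
      also have "\<dots> = (\<integral>\<omega>\<in>B. \<xi> \<omega> \<partial>M)"
        unfolding set_lebesgue_integral_def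
        by (rule integral_cong_AE) (use ae in auto)
      finally show "(\<integral>\<omega>\<in>B. X \<omega> \<partial>M) = (\<integral>\<omega>\<in>B. \<xi> \<omega> \<partial>M)" .
    qed
  next
    assume "\<forall>B\<in>sets G. (\<integral>\<omega>\<in>B. X \<omega> \<partial>M) = (\<integral>\<omega>\<in>B. \<xi> \<omega> \<partial>M)"
    then have "AE \<omega> in M. real_cond_exp M G X \<omega> = \<xi> \<omega>"
      using assms by (intro real_cond_exp_charact) auto
    then show "AE \<omega> in M. \<xi> \<omega> = real_cond_exp M G X \<omega>"
      by auto
  qed
qed

end

theory Submission
  imports Defs
begin

text \<open>
  Expanding the square shows that \<open>J\<close> has at \<open>u\<close> the Gateaux derivative
  \<open>v \<mapsto> \<integral> (u - X) v\<close>, which is continuous by Cauchy-Schwarz.  Hence \<open>u\<close> is critical iff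
  \<open>u - X\<close> is orthogonal to \<open>L\<^sup>2(\<Omega>, \<G>, P)\<close>.  Indicators of sets in \<open>\<G>\<close> lie in that space, so
  this orthogonality is the defining property of the conditional expectation; uniqueness of
  the critical point is then almost sure uniqueness of the conditional expectation.
\<close>

section \<open>Inner product and seminorm on square-integrable functions\<close>

lemma L2_space_integrable_mult:
  assumes "Y \<in> L2_space N" "Z \<in> L2_space N"
  shows "integrable N (\<lambda>\<omega>. Y \<omega> * Z \<omega>)"
proof (rule Bochner_Integration.integrable_bound)
  show "integrable N (\<lambda>\<omega>. (Y \<omega>)\<^sup>2 + (Z \<omega>)\<^sup>2)"
    using assms by (simp add: L2_space_def)
  show "(\<lambda>\<omega>. Y \<omega> * Z \<omega>) \<in> borel_measurable N"
    using assms by (auto simp: L2_space_def)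
  have "\<bar>y * z\<bar> \<le> y\<^sup>2 + z\<^sup>2" for y z :: real
  proof -
    have "\<bar>y * z\<bar> \<le> 2 * \<bar>y\<bar> * \<bar>z\<bar>"
      by (simp add: abs_mult)
    also have "\<dots> \<le> y\<^sup>2 + z\<^sup>2"
      using sum_squares_bound[of "\<bar>y\<bar>" "\<bar>z\<bar>"] by simp
    finally show ?thesis .
  qed
  then show "AE \<omega> in N. norm (Y \<omega> * Z \<omega>) \<le> norm ((Y \<omega>)\<^sup>2 + (Z \<omega>)\<^sup>2)"
    by auto
qed

text \<open>The form \<open>Y + c * Z\<close> matches the perturbation \<open>u + t * v\<close> of
  the difference quotient, and \<open>c = -1\<close> yields differences. In the expanded square only
  the cross term is new, and it is integrable as a product of two square-integrable
  functions.\<close>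

lemma L2_space_add_scaled:
  assumes "Y \<in> L2_space N" "Z \<in> L2_space N"
  shows "(\<lambda>\<omega>. Y \<omega> + c * Z \<omega>) \<in> L2_space N"
proof -
  have "integrable N (\<lambda>\<omega>. (Y \<omega>)\<^sup>2 + 2 * c * (Y \<omega> * Z \<omega>) + c\<^sup>2 * (Z \<omega>)\<^sup>2)"
    using assms L2_space_integrable_mult[OF assms] by (simp add: L2_space_def)
  then have "integrable N (\<lambda>\<omega>. (Y \<omega> + c * Z \<omega>)\<^sup>2)"
    by (simp add: power2_sum power_mult_distrib algebra_simps)
  then show ?thesis
    using assms by (auto simp: L2_space_def)
qed

lemma L2_space_diff:
  assumes "Y \<in> L2_space N" "Z \<in> L2_space N"
  shows "(\<lambda>\<omega>. Y \<omega> - Z \<omega>) \<in> L2_space N"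
  using L2_space_add_scaled[OF assms, of "-1"] by simp

lemma l2_inner_commute: "l2_inner N Y Z = l2_inner N Z Y"
  by (simp add: l2_inner_def mult.commute)

lemma l2_inner_add_scaled_right:
  assumes "W \<in> L2_space N" "Y \<in> L2_space N" "Z \<in> L2_space N"
  shows "l2_inner N W (\<lambda>\<omega>. Y \<omega> + c * Z \<omega>) = l2_inner N W Y + c * l2_inner N W Z"
proof -
  have "l2_inner N W (\<lambda>\<omega>. Y \<omega> + c * Z \<omega>) = (\<integral>\<omega>. W \<omega> * Y \<omega> + c * (W \<omega> * Z \<omega>) \<partial>N)"
    by (simp add: l2_inner_def algebra_simps)
  also have "\<dots> = l2_inner N W Y + c * l2_inner N W Z"
    using assms by (simp add: l2_inner_def L2_space_integrable_mult)
  finally show ?thesis .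
qed

lemma l2_inner_scale_right: "l2_inner N W (\<lambda>\<omega>. c * Y \<omega>) = c * l2_inner N W Y"
  by (simp add: l2_inner_def mult.left_commute)

lemma l2_inner_diff_right:
  assumes "W \<in> L2_space N" "Y \<in> L2_space N" "Z \<in> L2_space N"
  shows "l2_inner N W (\<lambda>\<omega>. Y \<omega> - Z \<omega>) = l2_inner N W Y - l2_inner N W Z"
  using l2_inner_add_scaled_right[OF assms, of "-1"] by simp

lemma l2_inner_self_nonneg: "0 \<le> l2_inner N Y Y"
  by (simp add: l2_inner_def)

lemma l2_inner_self_add_scaled:
  assumes "Y \<in> L2_space N" "Z \<in> L2_space N"
  shows "l2_inner N (\<lambda>\<omega>. Y \<omega> + c * Z \<omega>) (\<lambda>\<omega>. Y \<omega> + c * Z \<omega>)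
    = l2_inner N Y Y + 2 * c * l2_inner N Y Z + c\<^sup>2 * l2_inner N Z Z"
proof -
  let ?S = "\<lambda>\<omega>. Y \<omega> + c * Z \<omega>"
  have "l2_inner N ?S ?S = l2_inner N ?S Y + c * l2_inner N ?S Z"
    by (rule l2_inner_add_scaled_right[OF L2_space_add_scaled[OF assms] assms])
  \<comment> \<open>The expansion rule acts on the right argument, so symmetry moves the remaining
    \<open>?S\<close> there for a second expansion.\<close>
  then have "l2_inner N ?S ?S = l2_inner N Y ?S + c * l2_inner N Z ?S"
    by (simp only: l2_inner_commute[of N ?S Y] l2_inner_commute[of N ?S Z])
  then show ?thesis
    using assms
    by (simp add: l2_inner_add_scaled_right l2_inner_commute[of N Z Y] power2_eq_square
        algebra_simps)
qed

text \<open>Discriminant argument: the squared seminorm of \<open>Y + t * Z\<close> is a polynomial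
  of degree at most two in \<open>t\<close> that is never negative.\<close>

lemma l2_Cauchy_Schwarz:
  assumes "Y \<in> L2_space N" "Z \<in> L2_space N"
  shows "\<bar>l2_inner N Y Z\<bar> \<le> l2_norm N Y * l2_norm N Z"
proof -
  define a b c where "a = l2_inner N Y Y" and "b = l2_inner N Y Z" and "c = l2_inner N Z Z"
  have quad: "0 \<le> a + 2 * t * b + t\<^sup>2 * c" for t
    using l2_inner_self_nonneg[of N "\<lambda>\<omega>. Y \<omega> + t * Z \<omega>"] l2_inner_self_add_scaled[OF assms, of t]
    by (simp add: a_def b_def c_def)
  have "0 \<le> c"
    by (simp add: c_def l2_inner_self_nonneg)
  have "b\<^sup>2 \<le> a * c"
  proof (cases "c = 0")
    case True
    have "b = 0"
    proof (rule ccontr)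
      assume "b \<noteq> 0"
      then show False
        \<comment> \<open>With \<open>c = 0\<close> the polynomial is affine with slope
          \<open>2 * b\<close>; at this \<open>t\<close> its value would be -1.\<close>
        using quad[of "- (a + 1) / (2 * b)"] True by (simp add: field_simps)
    qed
    then show ?thesis
      using True by simp
  next
    case False
    with \<open>0 \<le> c\<close> have "0 < c"
      by simp
    \<comment> \<open>The polynomial is smallest at \<open>t = - b / c\<close>; the factor
      \<open>c\<close> clears the denominator.\<close>
    have "0 \<le> c * (a + 2 * (- b / c) * b + (- b / c)\<^sup>2 * c)"
      using quad \<open>0 \<le> c\<close> by (rule mult_nonneg_nonneg[rotated])
    also have "\<dots> = a * c - b\<^sup>2"
      using \<open>0 < c\<close> by (simp add: power2_eq_square algebra_simps)
    finally show ?thesis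
      by simp
  qed
  then have "\<bar>b\<bar> \<le> sqrt (a * c)"
    by (simp add: real_le_rsqrt)
  then show ?thesis
    by (simp add: l2_norm_def real_sqrt_mult a_def b_def c_def)
qed

section \<open>Passing between \<open>M\<close> and its restriction to \<open>G\<close>\<close>

lemma L2_space_restr_to_subalg_iff:
  assumes "subalgebra M G"
  shows "Y \<in> L2_space (restr_to_subalg M G) \<longleftrightarrow> Y \<in> borel_measurable G \<and> Y \<in> L2_space M"
proof
  assume Y: "Y \<in> L2_space (restr_to_subalg M G)"
  then have meas: "Y \<in> borel_measurable G"
    using measurable_in_subalg'[OF assms] by (auto simp: L2_space_def)
  with Y show "Y \<in> borel_measurable G \<and> Y \<in> L2_space M"
    using integrable_from_subalg[OF assms] measurable_from_subalg[OF assms]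
    by (auto simp: L2_space_def)
next
  assume Y: "Y \<in> borel_measurable G \<and> Y \<in> L2_space M"
  \<comment> \<open>Integrability transfers to the restricted measure only for a
    \<open>G\<close>-measurable integrand, here the square.\<close>
  then have "(\<lambda>\<omega>. (Y \<omega>)\<^sup>2) \<in> borel_measurable G"
    by auto
  with Y show "Y \<in> L2_space (restr_to_subalg M G)"
    using integrable_in_subalg[OF assms] measurable_in_subalg[OF assms]
    by (auto simp: L2_space_def)
qed

text \<open>Continuity of the derivative is measured in the restricted space, but \<open>X\<close>
  need not be \<open>G\<close>-measurable, so Cauchy-Schwarz has to be applied in \<open>M\<close>;
  this equality links the two seminorms.\<close>

lemma l2_norm_restr_to_subalg:
  assumes "subalgebra M G" "Y \<in> borel_measurable G"
  shows "l2_norm (restr_to_subalg M G) Y = l2_norm M Y"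
  unfolding l2_norm_def l2_inner_def using assms by (subst integral_subalgebra2) auto

section \<open>The Gateaux derivative of \<open>J\<close>\<close>

lemma J_functional_add_scaled:
  assumes "X \<in> L2_space M" "u \<in> L2_space M" "v \<in> L2_space M"
  shows "J_functional M X (\<lambda>\<omega>. u \<omega> + t * v \<omega>) - J_functional M X u
    = t * l2_inner M (\<lambda>\<omega>. u \<omega> - X \<omega>) v + t\<^sup>2 / 2 * l2_inner M v v"
proof -
  \<comment> \<open>In terms of inner products \<open>J\<close> is half a quadratic form minus a
    linear form, so its increment along \<open>v\<close> is an exact polynomial of degree at most
    two in \<open>t\<close>.\<close>
  have J: "J_functional M X Y = 1 / 2 * l2_inner M Y Y - l2_inner M X Y" for Y
    by (simp add: J_functional_def l2_inner_def power2_eq_square)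
  have D: "l2_inner M (\<lambda>\<omega>. u \<omega> - X \<omega>) v = l2_inner M u v - l2_inner M X v"
    using assms by (simp add: l2_inner_diff_right l2_inner_commute[of M _ v])
  show ?thesis
    using assms by (simp add: D J l2_inner_self_add_scaled l2_inner_add_scaled_right algebra_simps)
qed

lemma l2_continuous_inner:
  assumes "subalgebra M G" "f \<in> L2_space M"
  shows "l2_continuous (restr_to_subalg M G) (l2_inner M f)"
  unfolding l2_continuous_def
proof (intro ballI allI impI)
  let ?N = "restr_to_subalg M G"
  fix v :: "'a \<Rightarrow> real" and e :: real
  assume v: "v \<in> L2_space ?N" and "e > 0"
  have f_nonneg: "0 \<le> l2_norm M f"
    by (simp add: l2_norm_def l2_inner_self_nonneg)
  \<comment> \<open>The added 1 keeps the denominator positive when \<open>f\<close> has seminorm 0,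
    and makes the final bound strict.\<close>
  have "\<bar>l2_inner M f w - l2_inner M f v\<bar> < e"
    if w: "w \<in> L2_space ?N" and close: "l2_norm ?N (\<lambda>\<omega>. w \<omega> - v \<omega>) < e / (l2_norm M f + 1)" for w
  proof -
    let ?g = "\<lambda>\<omega>. w \<omega> - v \<omega>"
    have vw: "v \<in> L2_space M" "w \<in> L2_space M"
      using v w by (simp_all add: L2_space_restr_to_subalg_iff[OF assms(1)])
    have "?g \<in> borel_measurable G"
      using v w by (auto simp: L2_space_restr_to_subalg_iff[OF assms(1)])
    then have close_M: "l2_norm M ?g < e / (l2_norm M f + 1)"
      using close by (simp add: l2_norm_restr_to_subalg[OF assms(1)])
    have "\<bar>l2_inner M f w - l2_inner M f v\<bar> = \<bar>l2_inner M f ?g\<bar>"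
      using vw assms(2) by (simp add: l2_inner_diff_right)
    also have "\<dots> \<le> l2_norm M f * l2_norm M ?g"
      by (rule l2_Cauchy_Schwarz[OF assms(2) L2_space_diff[OF vw(2,1)]])
    also have "\<dots> \<le> l2_norm M f * (e / (l2_norm M f + 1))"
      using close_M f_nonneg by (intro mult_left_mono) auto
    also have "\<dots> < e"
      using \<open>e > 0\<close> f_nonneg by (simp add: field_simps)
    finally show ?thesis .
  qed
  moreover have "e / (l2_norm M f + 1) > 0"
    using \<open>e > 0\<close> f_nonneg by simp
  ultimately show "\<exists>d>0. \<forall>w\<in>L2_space ?N. l2_norm ?N (\<lambda>\<omega>. w \<omega> - v \<omega>) < d \<longrightarrow>
      \<bar>l2_inner M f w - l2_inner M f v\<bar> < e"
    by blast
qed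

lemma J_functional_difference_quotient:
  assumes "X \<in> L2_space M" "u \<in> L2_space M" "v \<in> L2_space M"
  shows "((\<lambda>t. (J_functional M X (\<lambda>\<omega>. u \<omega> + t * v \<omega>) - J_functional M X u) / t)
    \<longlongrightarrow> l2_inner M (\<lambda>\<omega>. u \<omega> - X \<omega>) v) (at 0)"
proof (rule Lim_transform_eventually)
  let ?D = "l2_inner M (\<lambda>\<omega>. u \<omega> - X \<omega>) v" and ?c = "l2_inner M v v"
  show "((\<lambda>t. ?D + t / 2 * ?c) \<longlongrightarrow> ?D) (at 0)"
    by (auto intro!: tendsto_eq_intros)
  \<comment> \<open>Off 0 the quotient is affine in \<open>t\<close>. At \<open>t = 0\<close>
    division by zero gives it the value 0, but the filter \<open>at 0\<close> leaves that point
    out.\<close>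
  have "?D + t / 2 * ?c = (J_functional M X (\<lambda>\<omega>. u \<omega> + t * v \<omega>) - J_functional M X u) / t"
    if "t \<noteq> 0" for t
    using that by (simp add: J_functional_add_scaled[OF assms] field_simps power2_eq_square)
  then show "\<forall>\<^sub>F t in at 0. ?D + t / 2 * ?c
      = (J_functional M X (\<lambda>\<omega>. u \<omega> + t * v \<omega>) - J_functional M X u) / t"
    by (simp add: eventually_at_filter)
qed

lemma has_gateaux_derivative_J_functional:
  assumes "subalgebra M G" "X \<in> L2_space M" "u \<in> L2_space (restr_to_subalg M G)"
  shows "has_gateaux_derivative (restr_to_subalg M G) (J_functional M X) u
    (l2_inner M (\<lambda>\<omega>. u \<omega> - X \<omega>))"
proof -
  note L2_iff = L2_space_restr_to_subalg_iff[OF assms(1)]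
  have u: "u \<in> L2_space M"
    using assms(3) by (simp add: L2_iff)
  let ?f = "\<lambda>\<omega>. u \<omega> - X \<omega>"
  have f: "?f \<in> L2_space M"
    by (rule L2_space_diff[OF u assms(2)])
  have "l2_linear (restr_to_subalg M G) (l2_inner M ?f)"
    using l2_inner_add_scaled_right[OF f, where c = 1]
    by (auto simp: l2_linear_def l2_inner_scale_right L2_iff)
  then show ?thesis
    using J_functional_difference_quotient[OF assms(2) u] l2_continuous_inner[OF assms(1) f]
    by (auto simp: has_gateaux_derivative_def L2_iff)
qed

section \<open>Critical points, orthogonality and conditional expectation\<close>

lemma critical_point_J_functional_iff:
  assumes "subalgebra M G" "X \<in> L2_space M" "u \<in> L2_space (restr_to_subalg M G)"
  shows "critical_point (restr_to_subalg M G) (J_functional M X) u \<longleftrightarrow>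
    (\<forall>v\<in>L2_space (restr_to_subalg M G). l2_inner M u v = l2_inner M X v)"
proof -
  let ?N = "restr_to_subalg M G" and ?D = "l2_inner M (\<lambda>\<omega>. u \<omega> - X \<omega>)"
  note L2_iff = L2_space_restr_to_subalg_iff[OF assms(1)]
  have u: "u \<in> L2_space M"
    using assms(3) by (simp add: L2_iff)
  have deriv: "has_gateaux_derivative ?N (J_functional M X) u ?D"
    by (rule has_gateaux_derivative_J_functional[OF assms])
  \<comment> \<open>Limits along \<open>at 0\<close> are unique, so every derivative agrees with
    \<open>?D\<close> on the space; the existential in \<open>critical_point\<close> thus becomes a
    condition on \<open>?D\<close> alone.\<close>
  have unique: "D v = ?D v" if "has_gateaux_derivative ?N (J_functional M X) u D"
    "v \<in> L2_space ?N" for D v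
    using deriv that unfolding has_gateaux_derivative_def
    by (meson tendsto_unique at_neq_bot)
  have "critical_point ?N (J_functional M X) u \<longleftrightarrow> (\<forall>v\<in>L2_space ?N. ?D v = 0)"
    unfolding critical_point_def
  proof safe
    fix D v
    assume "has_gateaux_derivative ?N (J_functional M X) u D" "\<forall>v\<in>L2_space ?N. D v = 0"
      and "v \<in> L2_space ?N"
    then show "?D v = 0"
      using unique[of D v] by simp
  next
    assume "\<forall>v\<in>L2_space ?N. ?D v = 0"
    with deriv show "\<exists>D. has_gateaux_derivative ?N (J_functional M X) u D \<and>
        (\<forall>v\<in>L2_space ?N. D v = 0)"
      by (intro exI[of _ ?D] conjI)
  qed (use assms(3) in simp)
  moreover have "?D v = l2_inner M u v - l2_inner M X v" if "v \<in> L2_space ?N" for v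
    using that u assms(2) by (simp add: L2_iff l2_inner_diff_right l2_inner_commute[of M _ v])
  ultimately show ?thesis
    by simp
qed

lemma AE_eq_real_cond_exp_iff_orthogonal:
  assumes "prob_space M" "subalgebra M G" "X \<in> L2_space M" "u \<in> L2_space (restr_to_subalg M G)"
  shows "(AE \<omega> in M. u \<omega> = real_cond_exp M G X \<omega>) \<longleftrightarrow>
    (\<forall>v\<in>L2_space (restr_to_subalg M G). l2_inner M u v = l2_inner M X v)"
proof -
  interpret prob_space M by fact
  interpret finite_measure_subalgebra M G
    by unfold_locales fact
  note L2_iff = L2_space_restr_to_subalg_iff[OF assms(2)]
  have u: "u \<in> borel_measurable G" "u \<in> L2_space M"
    using assms(4) by (simp_all add: L2_iff)
  have [measurable]: "X \<in> borel_measurable M" "u \<in> borel_measurable M"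
    using assms(3) u by (simp_all add: L2_space_def)
  have int: "integrable M X" "integrable M u"
    \<comment> \<open>On a probability space square-integrability implies integrability, as the
      characterisation of conditional expectation by integrals requires.\<close>
    using assms(3) u(2) by (auto simp: L2_space_def intro: square_integrable_imp_integrable)
  show ?thesis
  proof
    assume ae: "AE \<omega> in M. u \<omega> = real_cond_exp M G X \<omega>"
    show "\<forall>v\<in>L2_space (restr_to_subalg M G). l2_inner M u v = l2_inner M X v"
    proof
      fix v assume "v \<in> L2_space (restr_to_subalg M G)"
      then have v: "v \<in> borel_measurable G" "v \<in> L2_space M"
        by (simp_all add: L2_iff)
      then have [measurable]: "v \<in> borel_measurable M"
        by (simp add: L2_space_def)
      have "l2_inner M u v = (\<integral>\<omega>. v \<omega> * real_cond_exp M G X \<omega> \<partial>M)"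
        unfolding l2_inner_def by (rule integral_cong_AE) (use ae in auto)
      also have "\<dots> = (\<integral>\<omega>. v \<omega> * X \<omega> \<partial>M)"
        \<comment> \<open>A \<open>G\<close>-measurable factor may be kept when the conditional
          expectation is replaced by \<open>X\<close> under the integral, provided that
          \<open>v * X\<close> is integrable.\<close>
        by (rule real_cond_exp_intg(2)[OF L2_space_integrable_mult[OF v(2) assms(3)] v(1)]) simp
      also have "\<dots> = l2_inner M X v"
        by (simp add: l2_inner_def mult.commute)
      finally show "l2_inner M u v = l2_inner M X v" .
    qed
  next
    assume orth: "\<forall>v\<in>L2_space (restr_to_subalg M G). l2_inner M u v = l2_inner M X v"
    have "(\<integral>\<omega>\<in>B. X \<omega> \<partial>M) = (\<integral>\<omega>\<in>B. u \<omega> \<partial>M)" if B: "B \<in> sets G" for B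
    proof -
      have "B \<in> sets M"
        using B assms(2) by (auto simp: subalgebra_def)
      \<comment> \<open>An indicator is its own square, and the measure is finite.\<close>
      then have "(indicator B :: 'a \<Rightarrow> real) \<in> L2_space M"
        by (simp add: L2_space_def power2_eq_square emeasure_eq_measure
            flip: indicator_inter_arith)
      then have "l2_inner M u (indicator B) = l2_inner M X (indicator B)"
        using orth B by (simp add: L2_iff)
      then show ?thesis
        by (simp add: l2_inner_def set_lebesgue_integral_def mult.commute)
    qed
    then show "AE \<omega> in M. u \<omega> = real_cond_exp M G X \<omega>"
      using AE_eq_real_cond_exp_iff[OF assms(1,2) int(1) u(1) int(2)] by blast
  qed
qed

theorem theorem2p4:
  fixes M G :: "'a measure" and X \<xi> :: "'a \<Rightarrow> real"
  assumes "prob_space M"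
    and "subalgebra M G"
    and "X \<in> L2_space M"
    and "\<xi> \<in> L2_space (restr_to_subalg M G)"
  shows "(AE \<omega> in M. \<xi> \<omega> = real_cond_exp M G X \<omega>) \<longleftrightarrow>
    unique_critical_point (restr_to_subalg M G) (J_functional M X) \<xi>"
proof -
  let ?N = "restr_to_subalg M G"
  \<comment> \<open>Stated for every \<open>u\<close> in the space, since it is applied both to
    \<open>\<xi>\<close> and to a competing critical point \<open>w\<close>.\<close>
  have crit_iff: "critical_point ?N (J_functional M X) u \<longleftrightarrow>
      (AE \<omega> in M. u \<omega> = real_cond_exp M G X \<omega>)" if "u \<in> L2_space ?N" for u
    using critical_point_J_functional_iff[OF assms(2,3) that]
      AE_eq_real_cond_exp_iff_orthogonal[OF assms(1-3) that] by simp
  have "AE \<omega> in ?N. w \<omega> = \<xi> \<omega>"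
    if \<xi>: "AE \<omega> in M. \<xi> \<omega> = real_cond_exp M G X \<omega>"
      and crit: "critical_point ?N (J_functional M X) w" for w
  \<comment> \<open>Both functions agree with the conditional expectation almost everywhere in
    \<open>M\<close>. Passing to the restricted measure requires the set where they agree to be
    \<open>G\<close>-measurable, which follows from \<open>G\<close>-measurability of both.\<close>
  proof (rule AE_restr_to_subalg2[OF assms(2)])
    have w: "w \<in> L2_space ?N"
      using crit by (simp add: critical_point_def)
    have "AE \<omega> in M. w \<omega> = real_cond_exp M G X \<omega>"
      using crit crit_iff[OF w] by simp
    then show "AE \<omega> in M. w \<omega> = \<xi> \<omega>"
      using \<xi> by auto
    have [measurable]: "w \<in> borel_measurable G" "\<xi> \<in> borel_measurable G"
      using w assms(4) by (simp_all add: L2_space_restr_to_subalg_iff[OF assms(2)])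
    show "Measurable.pred G (\<lambda>\<omega>. w \<omega> = \<xi> \<omega>)"
      by measurable
  qed
  then show ?thesis
    using crit_iff[OF assms(4)] by (auto simp: unique_critical_point_def)
qed

end
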